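(* In the setting of the context, assume: (1) there exist functions $N_V,N_U\in C(I,\mathbb{R}_+)$ and a constant $L_G>0$ such that for all $t,s\in I$, $\vartheta_1,\vartheta_2\in\mathscr{C}$ and $x_1,x_2\in X$, $$\|V(t,\vartheta_1,x_1)-V(t,\vartheta_2,x_2)\|\le N_V(t)\left(\|\vartheta_1-\vartheta_2\|_{\mathscr{C}}+\|x_1-x_2\|\right),$$ $$\|U(t,s,\vartheta_1)-U(t,s,\vartheta_2)\|\le N_U(t)\,\|\vartheta_1-\vartheta_2\|_{\mathscr{C}},$$ $$\|G(t,\vartheta_1)-G(t,\vartheta_2)\|\le L_G\,\|\vartheta_1-\vartheta_2\|_{\mathscr{C}};$$ (2) there exist constants $D_k$ ($k=1,\dots,m$) such that $\|I_k(x_1)-I_k(x_2)\|\le D_k\|x_1-x_2\|$ for all $x_1,x_2\in X$ and $k=1,\dots,m$. Let $\varsigma_1,\varsigma_2\in\mathscr{C}$ and, for $i=1,2$, let $w_i$ be the mild solution of $$w'(t)=Aw(t)+V\Big(t,w_t,\int_0^tU(t,s,w_s)\,ds\Big),\quad t\in I,\ t\ne t_k,\ k=1,\dots,m,$$ $$w(t)=\varsigma_i(t),\quad t\in[-r,0],$$ $$\Delta w(t_k)=I_k\Big(\int_{t_k-\tau_k}^{t_k-\theta_k}G(s,w_s)\,ds\Big),\quad k=1,\dots,m.$$ Then $$\|w_1-w_2\|_{\Sigma}\le M\,\|\varsigma_1-\varsigma_2\|_{\mathscr{C}}\,\prod_{k=1}^{m}C_k\ \exp\left(\int_{t_m}^{b}M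 N_V(s)\Big[1+\int_0^sN_U(\sigma)\,d\sigma\Big]ds\right),$$ where, for $k=1,\dots,m$, $$C_k=\exp\left(\int_{t_{k-1}}^{t_k}M N_V(s)\Big[1+\int_0^sN_U(\sigma)d\sigma\Big]ds\right)+M L_G D_k\int_{t_k-\tau_k}^{t_k-\theta_k}\exp\left(\int_{t_{k-1}}^{s}M N_V(\sigma)\Big[1+\int_0^\sigma N_U(\xi)d\xi\Big]d\sigma\right)ds .$$
   Context: Let $(X,\|\cdot\|)$ be a Banach space, $b>0$, $0<r<\infty$, $I=[0,b]$, $\mathbb{R}_+=[0,\infty)$. Let $\mathscr{C}=C([-r,0],X)$ be the Banach space of continuous functions $[-r,0]\to X$ with the supremum norm $\|\cdot\|_{\mathscr{C}}$. Let $A:D(A)\subseteq X\to X$ be the infinitesimal generator of a strongly continuous semigroup $\{T(t)\}_{t\ge0}$ of bounded linear operators on $X$, and let $M\ge1$ be a constant with $\|T(t)\|\le M$ for all $t\ge0$. Let $0=t_0<t_1<\cdots<t_m<t_{m+1}=b$ and $0\le\theta_k\le\tau_k\le t_k-t_{k-1}$ for $k=1,\dots,m$. Let $V:I\times\mathscr{C}\times X\to X$, $U:I\times I\times\mathscr{C}\to X$ and $G:I\times\mathscr{C}\to X$ be given functions, and let $I_k\in C(X,X)$ ($k=1,\dots,m$) be bounded functions. For any continuous function $w$ defined on $[-r,b]\setminus\{t_1,\dots,t_m\}$ and $t\in[0,b]$, $w_t$ denotes the element of $\mathscr{C}$ defined by $w_t(\theta)=w(t+\theta)$, $\theta\in[-r,0]$.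 Also $w(t_k^{\pm})=\lim_{\epsilon\to0^{\pm}}w(t_k+\epsilon)$ and $\Delta w(t_k)=w(t_k^+)-w(t_k^-)$. Solutions are considered among functions $w:[-r,b]\to X$ equal to the given initial function on $[-r,0]$, continuous on $[0,t_1]$ and on each $(t_k,t_{k+1}]$ ($k=1,\dots,m$), for which $w(t_k^-)$ and $w(t_k^+)$ exist with $w(t_k^-)=w(t_k)$; for such functions and their differences, $\|w\|_\Sigma=\max_{0\le k\le m}\sup\{\|w(t)\|:t\in[t_k,t_{k+1}]\}$. A mild solution of the problem with initial function $\varsigma\in\mathscr{C}$ is a function $w:[-r,b]\to X$ with $w=\varsigma$ on $[-r,0]$ and, for all $t\in I$, $$w(t)=T(t)\varsigma(0)+\int_0^tT(t-s)V\Big(s,w_s,\int_0^sU(s,\sigma,w_\sigma)d\sigma\Big)ds+\sum_{0<t_k<t}T(t-t_k)I_k\Big(\int_{t_k-\tau_k}^{t_k-\theta_k}G(s,w_s)ds\Big).$$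
   Formalization: The bound on U is assumed with N_U(s) instead of N_U(t), since with N_U(t) the estimate is false; and V, U, G are defined, and (1) is assumed, on C([-r,0],X) together with the segments w_t of piecewise continuous functions, since w_t need not be continuous after a jump. *)

theory Defs
  imports "HOL-Analysis.Analysis"
begin

definition C0_semigroup :: "(real \<Rightarrow> 'a::real_normed_vector \<Rightarrow>\<^sub>L 'a) \<Rightarrow> bool" where
  "C0_semigroup T \<longleftrightarrow>
     T 0 = id_blinfun \<and>
     (\<forall>s\<ge>0. \<forall>t\<ge>0. T (s + t) = T s o\<^sub>L T t) \<and>
     (\<forall>x. ((\<lambda>t. T t x) \<longlongrightarrow> x) (at_right 0))"

definition infinitesimal_generator ::
    "(real \<Rightarrow> 'a::real_normed_vector \<Rightarrow>\<^sub>L 'a) \<Rightarrow> 'a set \<Rightarrow> ('a \<Rightarrow> 'a) \<Rightarrow> bool" where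
  "infinitesimal_generator T D A \<longleftrightarrow>
     D = {x. \<exists>y. ((\<lambda>h. (T h x - x) /\<^sub>R h) \<longlongrightarrow> y) (at_right 0)} \<and>
     (\<forall>x\<in>D. ((\<lambda>h. (T h x - x) /\<^sub>R h) \<longlongrightarrow> A x) (at_right 0))"

(* Functions on [-r,0] are represented by total functions that are undefined off [-r,0],
   so that equality of representatives is equality on [-r,0]. *)

definition cont_histories :: "real \<Rightarrow> (real \<Rightarrow> 'a::real_normed_vector) set" where
  "cont_histories r = {\<phi> \<in> extensional {-r..0}. continuous_on {-r..0} \<phi>}"

definition history_norm :: "real \<Rightarrow> (real \<Rightarrow> 'a::real_normed_vector) \<Rightarrow> real" where
  "history_norm r \<phi> = (SUP \<theta>\<in>{-r..0}. norm (\<phi> \<theta>))"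

definition segment_at :: "real \<Rightarrow> (real \<Rightarrow> 'a) \<Rightarrow> real \<Rightarrow> real \<Rightarrow> 'a" where
  "segment_at r w t = restrict (\<lambda>\<theta>. w (t + \<theta>)) {-r..0}"

(* The class in which solutions are sought.  Here p 0 < ... < p (m + 1) are the times
   t_0 < ... < t_(m+1); only the values of w on [-r, p (m + 1)] matter. *)
definition solution_class ::
    "real \<Rightarrow> nat \<Rightarrow> (nat \<Rightarrow> real) \<Rightarrow> (real \<Rightarrow> 'a::real_normed_vector) set" where
  "solution_class r m p = {w.
     continuous_on {-r..0} w \<and>
     continuous_on {0..p 1} w \<and>
     (\<forall>k\<in>{1..m}. continuous_on {p k<..p (k + 1)} w) \<and>
     (\<forall>k\<in>{1..m}. (w \<longlongrightarrow> w (p k)) (at_left (p k))) \<and>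
     (\<forall>k\<in>{1..m}. \<exists>l. (w \<longlongrightarrow> l) (at_right (p k)))}"

(* The space of histories on which the nonlinearities act.  If w jumps at t_k, then its
   segment w_t is discontinuous for t_k < t <= t_k + r, so C([-r,0],X) has to be enlarged by the segments of
   functions in the solution class for V(t, w_t, x) etc. to make sense.  Nothing else is
   added. *)
definition histories ::
    "real \<Rightarrow> nat \<Rightarrow> (nat \<Rightarrow> real) \<Rightarrow> (real \<Rightarrow> 'a::real_normed_vector) set" where
  "histories r m p = cont_histories r \<union>
     {segment_at r w t |w t. w \<in> solution_class r m p \<and> t \<in> {0..p (m + 1)}}"

definition sigma_norm ::
    "nat \<Rightarrow> (nat \<Rightarrow> real) \<Rightarrow> (real \<Rightarrow> 'a::real_normed_vector) \<Rightarrow> real" where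
  "sigma_norm m p w = Max ((\<lambda>k. SUP t\<in>{p k..p (k + 1)}. norm (w t)) ` {0..m})"

(* Integrals are Henstock-Kurzweil integrals.  They extend the Bochner integral, do not need
   X to be separable, and have the junk value 0 for functions that are not integrable; this is
   why integrability of every integrand is part of the definition. *)
definition mild_solution ::
    "real \<Rightarrow> nat \<Rightarrow> (nat \<Rightarrow> real) \<Rightarrow> (nat \<Rightarrow> real) \<Rightarrow> (nat \<Rightarrow> real) \<Rightarrow>
     (real \<Rightarrow> 'a::banach \<Rightarrow>\<^sub>L 'a) \<Rightarrow>
     (real \<Rightarrow> (real \<Rightarrow> 'a) \<Rightarrow> 'a \<Rightarrow> 'a) \<Rightarrow>
     (real \<Rightarrow> real \<Rightarrow> (real \<Rightarrow> 'a) \<Rightarrow> 'a) \<Rightarrow>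
     (real \<Rightarrow> (real \<Rightarrow> 'a) \<Rightarrow> 'a) \<Rightarrow>
     (nat \<Rightarrow> 'a \<Rightarrow> 'a) \<Rightarrow> (real \<Rightarrow> 'a) \<Rightarrow> (real \<Rightarrow> 'a) \<Rightarrow> bool" where
  "mild_solution r m p \<theta> \<tau> T V U G J \<zeta> w \<longleftrightarrow>
     w \<in> solution_class r m p \<and>
     (\<forall>t\<in>{-r..0}. w t = \<zeta> t) \<and>
     (\<forall>s\<in>{0..p (m + 1)}. (\<lambda>\<sigma>. U s \<sigma> (segment_at r w \<sigma>)) integrable_on {0..s}) \<and>
     (\<forall>t\<in>{0..p (m + 1)}.
        (\<lambda>s. T (t - s) (V s (segment_at r w s)
               (integral {0..s} (\<lambda>\<sigma>. U s \<sigma> (segment_at r w \<sigma>))))) integrable_on {0..t}) \<and>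
     (\<forall>k\<in>{1..m}. (\<lambda>s. G s (segment_at r w s)) integrable_on {p k - \<tau> k..p k - \<theta> k}) \<and>
     (\<forall>t\<in>{0..p (m + 1)}.
        w t = T t (\<zeta> 0)
          + integral {0..t} (\<lambda>s. T (t - s) (V s (segment_at r w s)
               (integral {0..s} (\<lambda>\<sigma>. U s \<sigma> (segment_at r w \<sigma>)))))
          + (\<Sum>k | k \<in> {1..m} \<and> 0 < p k \<and> p k < t.
               T (t - p k) (J k (integral {p k - \<tau> k..p k - \<theta> k}
                  (\<lambda>s. G s (segment_at r w s))))))"

end

theory Submission
  imports Defs
begin

text \<open>
  Let \<open>z t\<close> be the supremum of \<open>norm (w\<^sub>1 s - w\<^sub>2 s)\<close> over \<open>s \<in> {-r..t}\<close>. It is monotone and dominates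
  the history norm of the difference of the segments at \<open>t\<close>, so subtracting the two integral
  equations gives an integral inequality for \<open>z\<close> with kernel
  \<open>f s = M * N\<^sub>V s * (1 + integral {0..s} N\<^sub>U)\<close>; monotonicity lets \<open>z s\<close> be pulled out of the inner
  integral. On each interval between impulses the classical Gronwall inequality applies, and
  passing over the \<open>k\<close>-th impulse multiplies the constant by at most \<open>C k\<close>.
\<close>

section \<open>Gronwall inequalities for integrable functions, without and with impulses\<close>

text \<open>The estimate is for the integral majorant at \<open>u\<close>, which dominates
  \<open>z u\<close>, because this majorant is what is carried over to the interval after an
  impulse. It holds since \<open>W\<close> has derivative \<open>f * Y\<close> and
  \<open>Y \<le> W\<close>, so \<open>W\<close> times \<open>exp (- integral {l..t} f)\<close> is
  nonincreasing and starts at \<open>a\<close>.\<close>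

lemma gronwall_integral:
  fixes f z :: "real \<Rightarrow> real"
  assumes lu: "l \<le> u"
    and f: "continuous_on {l..u} f" "\<And>t. t \<in> {l..u} \<Longrightarrow> f t \<ge> 0"
    and fz: "(\<lambda>s. f s * z s) integrable_on {l..u}"
    and z: "\<And>t. t \<in> {l..u} \<Longrightarrow> z t \<le> a + integral {l..t} (\<lambda>s. f s * z s)"
  shows "a + integral {l..u} (\<lambda>s. f s * z s) \<le> a * exp (integral {l..u} f)"
proof -
  \<comment> \<open>\<open>z\<close> is only integrable; its majorant \<open>Y\<close> is continuous, so \<open>W\<close> can be differentiated.\<close>
  define Y where "Y t = a + integral {l..t} (\<lambda>s. f s * z s)" for t
  define W where "W t = a + integral {l..t} (\<lambda>s. f s * Y s)" for t
  define H where "H t = W t * exp (- integral {l..t} f)" for t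
  have contY: "continuous_on {l..u} Y"
    unfolding Y_def by (intro continuous_intros indefinite_integral_continuous_1 fz)
  then have contfY: "continuous_on {l..u} (\<lambda>s. f s * Y s)"
    by (intro continuous_intros f)
  have YW: "Y t \<le> W t" if t: "t \<in> {l..u}" for t
  proof -
    have sub: "{l..t} \<subseteq> {l..u}"
      using t by auto
    have "integral {l..t} (\<lambda>s. f s * z s) \<le> integral {l..t} (\<lambda>s. f s * Y s)"
    proof (rule integral_le)
      show "(\<lambda>s. f s * z s) integrable_on {l..t}"
        using fz sub by (rule integrable_subinterval_real)
      show "(\<lambda>s. f s * Y s) integrable_on {l..t}"
        using contfY sub by (intro integrable_continuous_real) (rule continuous_on_subset)
      show "f s * z s \<le> f s * Y s" if "s \<in> {l..t}" for s
        using z[of s] f(2)[of s] that sub by (auto simp: Y_def intro!: mult_left_mono)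
    qed
    then show ?thesis
      by (simp add: Y_def W_def)
  qed
  have "H u \<le> H l"
  proof (rule DERIV_nonpos_imp_decreasing_open[OF lu])
    have "continuous_on {l..u} (\<lambda>t. integral {l..t} (\<lambda>s. f s * Y s))"
      "continuous_on {l..u} (\<lambda>t. integral {l..t} f)"
      by (intro indefinite_integral_continuous_1 integrable_continuous_real contfY f)+
    then show "continuous_on {l..u} H"
      unfolding H_def W_def by (intro continuous_intros)
  next
    fix x assume x: "l < x" "x < u"
    then have at: "at x within {l..u} = at x"
      by (simp add: at_within_Icc_at)
    have dW: "(W has_real_derivative f x * Y x) (at x)"
      using integral_has_real_derivative[OF contfY, of x] x at
      unfolding W_def by (auto intro!: derivative_eq_intros)
    have dF: "((\<lambda>t. integral {l..t} f) has_real_derivative f x) (at x)"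
      using integral_has_real_derivative[OF f(1), of x] x at by auto
    have "(H has_real_derivative f x * (Y x - W x) * exp (- integral {l..x} f)) (at x)"
      unfolding H_def using dW dF
      by (auto intro!: derivative_eq_intros simp: algebra_simps)
    moreover have "f x * (Y x - W x) * exp (- integral {l..x} f) \<le> 0"
      using YW[of x] f(2)[of x] x by (intro mult_nonpos_nonneg mult_nonneg_nonpos) auto
    ultimately show "\<exists>y. (H has_real_derivative y) (at x) \<and> y \<le> 0"
      by blast
  qed
  then have "W u \<le> a * exp (integral {l..u} f)"
    by (simp add: H_def W_def exp_minus field_simps)
  with YW[of u] lu show ?thesis
    by (simp add: Y_def)
qed

lemma partition_mono:
  fixes p :: "nat \<Rightarrow> 'a::order"
  assumes "\<And>k. k \<le> m \<Longrightarrow> p k < p (k + 1)" "i \<le> j" "j \<le> m + 1"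
  shows "p i \<le> p j"
  using assms(2,3)
proof (induction j rule: dec_induct)
  case (step n)
  then show ?case
    using assms(1)[of n] by (auto dest: less_imp_le intro: order_trans)
qed simp

text \<open>Induction over the intervals between impulses. The plain inequality gives the
  exponential growth up to the next impulse time, and the window of that impulse lies in the
  interval just treated, so its integral is controlled by the same exponential. These two
  contributions are the two summands of \<open>C k\<close>.\<close>

lemma impulsive_gronwall:
  fixes f z :: "real \<Rightarrow> real" and p \<alpha> \<gamma> \<beta> C :: "nat \<Rightarrow> real"
  assumes p: "\<And>k. k \<le> m \<Longrightarrow> p k < p (k + 1)"
    and f: "continuous_on {p 0..p (m + 1)} f" "\<And>t. t \<in> {p 0..p (m + 1)} \<Longrightarrow> f t \<ge> 0"
    and z: "z integrable_on {p 0..p (m + 1)}" "\<And>t. t \<in> {p 0..p (m + 1)} \<Longrightarrow> z t \<ge> 0"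
    and fz: "(\<lambda>s. f s * z s) integrable_on {p 0..p (m + 1)}"
    and \<beta>: "\<And>k. k \<in> {1..m} \<Longrightarrow> \<beta> k \<ge> 0"
    and \<alpha>\<gamma>: "\<And>k. k \<in> {1..m} \<Longrightarrow> p (k - 1) \<le> \<alpha> k \<and> \<gamma> k \<le> p k"
    and ineq: "\<And>t. t \<in> {p 0..p (m + 1)} \<Longrightarrow>
           z t \<le> c + integral {p 0..t} (\<lambda>s. f s * z s)
             + (\<Sum>k | k \<in> {1..m} \<and> p k < t. \<beta> k * integral {\<alpha> k..\<gamma> k} z)"
    and C: "\<And>k. k \<in> {1..m} \<Longrightarrow> C k = exp (integral {p (k - 1)..p k} f)
           + \<beta> k * integral {\<alpha> k..\<gamma> k} (\<lambda>s. exp (integral {p (k - 1)..s} f))"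
  shows "z (p (m + 1)) \<le> c * (\<Prod>k = 1..m. C k) * exp (integral {p m..p (m + 1)} f)"
proof -
  have mono: "p i \<le> p j" if "i \<le> j" "j \<le> m + 1" for i j
    using p that by (rule partition_mono)
  \<comment> \<open>\<open>a k\<close> is the right limit at \<open>p k\<close> of the bound in \<open>ineq\<close>.\<close>
  define a where "a k = c + integral {p 0..p k} (\<lambda>s. f s * z s)
    + (\<Sum>j = 1..k. \<beta> j * integral {\<alpha> j..\<gamma> j} z)" for k
  have sub: "{p k..t} \<subseteq> {p 0..p (m + 1)}" if "k \<le> m" "t \<le> p (k + 1)" for k t
    using mono[of 0 k] mono[of "k + 1" "m + 1"] that by auto
  have intz: "z integrable_on {\<alpha> k..\<gamma> k}" "integral {\<alpha> k..\<gamma> k} z \<ge> 0"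
    and sub': "{\<alpha> k..\<gamma> k} \<subseteq> {p (k - 1)..p k}" if k: "k \<in> {1..m}" for k
  proof -
    show *: "{\<alpha> k..\<gamma> k} \<subseteq> {p (k - 1)..p k}"
      using \<alpha>\<gamma>[OF k] by auto
    also have "\<dots> \<subseteq> {p 0..p (m + 1)}"
      using sub[of "k - 1" "p k"] k by auto
    finally have "{\<alpha> k..\<gamma> k} \<subseteq> {p 0..p (m + 1)}" .
    with z show "z integrable_on {\<alpha> k..\<gamma> k}" "integral {\<alpha> k..\<gamma> k} z \<ge> 0"
      by (blast intro: integrable_subinterval_real integral_nonneg)+
  qed
  have zle: "z t \<le> a k + integral {p k..t} (\<lambda>s. f s * z s)" if k: "k \<le> m" and t: "t \<in> {p k..p (k + 1)}" for k t
  proof -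
    have t': "t \<in> {p 0..p (m + 1)}"
      using sub[OF k, of t] t by auto
    \<comment> \<open>Because of the strict \<open>p j < t\<close>, the impulse at
      \<open>p (k + 1)\<close> is still absent at the right endpoint, while the one at
      \<open>p k\<close> is absent at the left endpoint. Inclusion is all that holds on the closed
      interval, and it suffices since the summands are nonnegative.\<close>
    have "{j. j \<in> {1..m} \<and> p j < t} \<subseteq> {1..k}"
    proof
      fix j assume "j \<in> {j. j \<in> {1..m} \<and> p j < t}"
      with t mono[of "k + 1" j] show "j \<in> {1..k}"
        by (cases "k + 1 \<le> j") auto
    qed
    then have "(\<Sum>j | j \<in> {1..m} \<and> p j < t. \<beta> j * integral {\<alpha> j..\<gamma> j} z)
      \<le> (\<Sum>j = 1..k. \<beta> j * integral {\<alpha> j..\<gamma> j} z)"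
      using k \<beta> intz by (intro sum_mono2) auto
    moreover have "integral {p 0..t} (\<lambda>s. f s * z s)
      = integral {p 0..p k} (\<lambda>s. f s * z s) + integral {p k..t} (\<lambda>s. f s * z s)"
      using t t' mono[of 0 k] k fz
      by (intro Henstock_Kurzweil_Integration.integral_combine[symmetric]) (auto intro: integrable_subinterval_real)
    ultimately show ?thesis
      using ineq[OF t'] by (simp add: a_def)
  qed
  \<comment> \<open>This serves twice: at \<open>t = p (k + 1)\<close> it gives the growth of the
    majorant over the whole interval, and at arbitrary \<open>t\<close> it yields the pointwise
    bound \<open>bnd\<close> for \<open>z\<close>, used inside the impulse window.\<close>
  have gron: "a k + integral {p k..t} (\<lambda>s. f s * z s) \<le> a k * exp (integral {p k..t} f)"
    if k: "k \<le> m" and t: "t \<in> {p k..p (k + 1)}" for k t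
  proof (rule gronwall_integral)
    have *: "{p k..t} \<subseteq> {p 0..p (m + 1)}"
      using sub[OF k, of t] t by auto
    show "continuous_on {p k..t} f"
      using f(1) * by (rule continuous_on_subset)
    show "(\<lambda>s. f s * z s) integrable_on {p k..t}"
      using fz * by (rule integrable_subinterval_real)
    show "f s \<ge> 0" if "s \<in> {p k..t}" for s
      using f(2) * that by blast
    show "z s \<le> a k + integral {p k..s} (\<lambda>s. f s * z s)" if "s \<in> {p k..t}" for s
      using zle[OF k, of s] t that by auto
  qed (use t in auto)
  have bnd: "z t \<le> a k * exp (integral {p k..t} f)" if "k \<le> m" "t \<in> {p k..p (k + 1)}" for k t
    using zle[OF that] gron[OF that] by linarith
  have exp_cont: "continuous_on {p k..p (k + 1)} (\<lambda>s. exp (integral {p k..s} f))" if "k \<le> m" for k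
    using f(1) sub[OF that, of "p (k + 1)"]
    by (intro continuous_intros indefinite_integral_continuous_1 integrable_continuous_real)
      (auto intro: continuous_on_subset)
  have exp_int: "(\<lambda>s. exp (integral {p k..s} f)) integrable_on {\<alpha> (Suc k)..\<gamma> (Suc k)}" if "Suc k \<le> m" for k
    using exp_cont[of k] sub'[of "Suc k"] that
    by (intro integrable_continuous_real) (auto intro: continuous_on_subset)
  \<comment> \<open>Passing from \<open>a k\<close> to \<open>a (Suc k)\<close> adds the integral of
    \<open>f * z\<close> over one interval and one impulse term. \<open>gron\<close> absorbs the
    former into the first summand of \<open>C (Suc k)\<close>; inserting \<open>bnd\<close> into the
    window integral turns the latter into \<open>a k\<close> times the second summand.\<close>
  have step: "a (Suc k) \<le> a k * C (Suc k)" if k: "Suc k \<le> m" for k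
  proof -
    have "integral {\<alpha> (Suc k)..\<gamma> (Suc k)} z
      \<le> integral {\<alpha> (Suc k)..\<gamma> (Suc k)} (\<lambda>s. a k * exp (integral {p k..s} f))"
    proof (rule integral_le)
      show "z s \<le> a k * exp (integral {p k..s} f)" if "s \<in> {\<alpha> (Suc k)..\<gamma> (Suc k)}" for s
        using bnd[of k s] sub'[of "Suc k"] k that by auto
    qed (use exp_int[OF k] intz[of "Suc k"] k in \<open>auto intro: integrable_on_mult_right\<close>)
    then have "\<beta> (Suc k) * integral {\<alpha> (Suc k)..\<gamma> (Suc k)} z
      \<le> \<beta> (Suc k) * (a k * integral {\<alpha> (Suc k)..\<gamma> (Suc k)} (\<lambda>s. exp (integral {p k..s} f)))"
      using \<beta>[of "Suc k"] k by (intro mult_left_mono) auto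
    moreover have "a k + integral {p k..p (Suc k)} (\<lambda>s. f s * z s) \<le> a k * exp (integral {p k..p (Suc k)} f)"
      using gron[of k "p (k + 1)"] p[of k] k by auto
    moreover have "integral {p 0..p k} (\<lambda>s. f s * z s) + integral {p k..p (Suc k)} (\<lambda>s. f s * z s)
      = integral {p 0..p (Suc k)} (\<lambda>s. f s * z s)"
      using mono[of 0 k] mono[of k "Suc k"] mono[of "Suc k" "m + 1"] k fz
      by (intro Henstock_Kurzweil_Integration.integral_combine) (auto intro: integrable_subinterval_real)
    ultimately show ?thesis
      using C[of "Suc k"] k by (simp add: a_def algebra_simps)
  qed
  have Cpos: "C k \<ge> 0" if k: "k \<in> {1..m}" for k
    using C[OF k] \<beta>[OF k] exp_int[of "k - 1"] k by (auto intro!: add_nonneg_nonneg mult_nonneg_nonneg integral_nonneg)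
  have "a k \<le> c * (\<Prod>j = 1..k. C j)" if "k \<le> m" for k
    using that
  proof (induction k)
    case 0
    then show ?case
      by (simp add: a_def)
  next
    case (Suc k)
    have "a (Suc k) \<le> a k * C (Suc k)"
      using Suc.prems by (rule step)
    also have "\<dots> \<le> (c * (\<Prod>j = 1..k. C j)) * C (Suc k)"
      using Suc Cpos[of "Suc k"] by (intro mult_right_mono) auto
    finally show ?case
      by (simp add: mult.assoc)
  qed
  then have "a m * exp (integral {p m..p (m + 1)} f)
    \<le> c * (\<Prod>k = 1..m. C k) * exp (integral {p m..p (m + 1)} f)"
    by (intro mult_right_mono) auto
  moreover have "z (p (m + 1)) \<le> a m * exp (integral {p m..p (m + 1)} f)"
    using p[of m] by (intro bnd) auto
  ultimately show ?thesis
    by linarith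
qed

text \<open>Replacing the value at \<open>a\<close> by the right limit \<open>l\<close> gives a
  continuous function on the compact interval \<open>{a..b}\<close>, whose image is bounded.\<close>

lemma bounded_image_half_open:
  fixes w :: "real \<Rightarrow> 'a::real_normed_vector"
  assumes "a < b" "continuous_on {a<..b} w" "(w \<longlongrightarrow> l) (at_right a)"
  shows "bounded (w ` {a<..b})"
proof -
  define v where "v = w(a := l)"
  have "continuous_on {a..b} v"
  proof (rule continuous_on_IccI)
    show "(v \<longlongrightarrow> v a) (at_right a)"
      using assms(3) by (auto simp: v_def eventually_at_filter elim: Lim_transform_eventually)
    have "(w \<longlongrightarrow> w x) (at x within {a<..b})" if "a < x" "x \<le> b" for x
      using assms(2) that by (auto simp: continuous_on_def)
    note w = this
    have "at b within {a<..b} = at_left b"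
      using assms(1) by (intro at_within_nhd[of b "{a<..}"]) auto
    with w[of b] have "(w \<longlongrightarrow> w b) (at_left b)"
      using assms(1) by auto
    moreover have "\<forall>\<^sub>F x in at_left b. w x = v x"
      using eventually_at_left_real[OF assms(1)] by eventually_elim (simp add: v_def)
    ultimately show "(v \<longlongrightarrow> v b) (at_left b)"
      using assms(1) by (auto simp: v_def elim: Lim_transform_eventually)
    show "v \<midarrow>x\<rightarrow> v x" if x: "a < x" "x < b" for x
    proof -
      have "continuous_on {a<..<b} v \<longleftrightarrow> continuous_on {a<..<b} w"
        by (rule continuous_on_cong) (auto simp: v_def)
      then have "continuous_on {a<..<b} v"
        using assms(2) by (auto intro: continuous_on_subset)
      then show ?thesis
        using x by (auto simp: continuous_on_eq_continuous_at isCont_def)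
    qed
  qed (rule assms)
  then have "bounded (v ` {a..b})"
    by (intro compact_imp_bounded compact_continuous_image) auto
  then show ?thesis
    by (rule bounded_subset) (auto simp: v_def image_iff)
qed

text \<open>This makes the suprema of differences of solutions finite. The pieces are adjoined one
  at a time: the first two are compact, each later one is half-open with a right limit at its left
  end.\<close>

lemma solution_class_bounded:
  fixes w :: "real \<Rightarrow> 'a::real_normed_vector"
  assumes w: "w \<in> solution_class r m p"
    and p: "p 0 = 0" "\<And>k. k \<le> m \<Longrightarrow> p k < p (k + 1)"
  shows "bounded (w ` {-r..p (m + 1)})"
proof -
  have "bounded (w ` {-r..p (k + 1)})" if "k \<le> m" for k
    using that
  proof (induction k)
    case 0
    have "continuous_on {-r..0} w" "continuous_on {0..p 1} w"
      using w by (auto simp: solution_class_def)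
    then have "bounded (w ` {-r..0} \<union> w ` {0..p 1})"
      by (auto intro!: compact_imp_bounded compact_continuous_image)
    then show ?case
      by (rule bounded_subset) fastforce
  next
    case (Suc k)
    from w Suc.prems obtain l where "continuous_on {p (Suc k)<..p (Suc k + 1)} w"
      "(w \<longlongrightarrow> l) (at_right (p (Suc k)))"
      unfolding solution_class_def by force
    then have "bounded (w ` {p (Suc k)<..p (Suc k + 1)})"
      using p(2)[OF Suc.prems] by (intro bounded_image_half_open)
    with Suc have "bounded (w ` {-r..p (k + 1)} \<union> w ` {p (Suc k)<..p (Suc k + 1)})"
      by auto
    then show ?case
      by (rule bounded_subset) fastforce
  qed
  then show ?thesis
    by blast
qed

section \<open>Stability estimate for two mild solutions\<close>

theorem theorem4p1:
  fixes b r M L\<^sub>G :: real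
    and m :: nat
    and p \<theta> \<tau> D :: "nat \<Rightarrow> real"
    and T :: "real \<Rightarrow> 'a::banach \<Rightarrow>\<^sub>L 'a"
    and A :: "'a \<Rightarrow> 'a" and dom\<^sub>A :: "'a set"
    and V :: "real \<Rightarrow> (real \<Rightarrow> 'a) \<Rightarrow> 'a \<Rightarrow> 'a"
    and U :: "real \<Rightarrow> real \<Rightarrow> (real \<Rightarrow> 'a) \<Rightarrow> 'a"
    and G :: "real \<Rightarrow> (real \<Rightarrow> 'a) \<Rightarrow> 'a"
    and J :: "nat \<Rightarrow> 'a \<Rightarrow> 'a"
    and N\<^sub>V N\<^sub>U :: "real \<Rightarrow> real"
    and \<zeta>\<^sub>1 \<zeta>\<^sub>2 w\<^sub>1 w\<^sub>2 :: "real \<Rightarrow> 'a"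
    and C :: "nat \<Rightarrow> real"
  assumes "b > 0" and "r > 0"
    and "C0_semigroup T" and "infinitesimal_generator T dom\<^sub>A A"
    and "M \<ge> 1" and "\<And>t. t \<ge> 0 \<Longrightarrow> norm (T t) \<le> M"
    and "p 0 = 0" and "p (m + 1) = b" and "\<And>k. k \<le> m \<Longrightarrow> p k < p (k + 1)"
    and "\<And>k. k \<in> {1..m} \<Longrightarrow> 0 \<le> \<theta> k \<and> \<theta> k \<le> \<tau> k \<and> \<tau> k \<le> p k - p (k - 1)"
    and "\<And>k. k \<in> {1..m} \<Longrightarrow> continuous_on UNIV (J k) \<and> bounded (range (J k))"
    and "continuous_on {0..b} N\<^sub>V" and "\<And>t. t \<in> {0..b} \<Longrightarrow> N\<^sub>V t \<ge> 0"
    and "continuous_on {0..b} N\<^sub>U" and "\<And>t. t \<in> {0..b} \<Longrightarrow> N\<^sub>U t \<ge> 0"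
    and "L\<^sub>G > 0"
    and "\<And>t \<phi>\<^sub>1 \<phi>\<^sub>2 x\<^sub>1 x\<^sub>2. \<lbrakk>t \<in> {0..b}; \<phi>\<^sub>1 \<in> histories r m p; \<phi>\<^sub>2 \<in> histories r m p\<rbrakk> \<Longrightarrow>
           norm (V t \<phi>\<^sub>1 x\<^sub>1 - V t \<phi>\<^sub>2 x\<^sub>2)
             \<le> N\<^sub>V t * (history_norm r (\<lambda>u. \<phi>\<^sub>1 u - \<phi>\<^sub>2 u) + norm (x\<^sub>1 - x\<^sub>2))"
    and "\<And>t s \<phi>\<^sub>1 \<phi>\<^sub>2. \<lbrakk>t \<in> {0..b}; s \<in> {0..b}; \<phi>\<^sub>1 \<in> histories r m p; \<phi>\<^sub>2 \<in> histories r m p\<rbrakk> \<Longrightarrow>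
           norm (U t s \<phi>\<^sub>1 - U t s \<phi>\<^sub>2) \<le> N\<^sub>U s * history_norm r (\<lambda>u. \<phi>\<^sub>1 u - \<phi>\<^sub>2 u)"
    and "\<And>t \<phi>\<^sub>1 \<phi>\<^sub>2. \<lbrakk>t \<in> {0..b}; \<phi>\<^sub>1 \<in> histories r m p; \<phi>\<^sub>2 \<in> histories r m p\<rbrakk> \<Longrightarrow>
           norm (G t \<phi>\<^sub>1 - G t \<phi>\<^sub>2) \<le> L\<^sub>G * history_norm r (\<lambda>u. \<phi>\<^sub>1 u - \<phi>\<^sub>2 u)"
    and "\<And>k x\<^sub>1 x\<^sub>2. k \<in> {1..m} \<Longrightarrow> norm (J k x\<^sub>1 - J k x\<^sub>2) \<le> D k * norm (x\<^sub>1 - x\<^sub>2)"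
    and "\<zeta>\<^sub>1 \<in> cont_histories r" and "\<zeta>\<^sub>2 \<in> cont_histories r"
    and "mild_solution r m p \<theta> \<tau> T V U G J \<zeta>\<^sub>1 w\<^sub>1"
    and "mild_solution r m p \<theta> \<tau> T V U G J \<zeta>\<^sub>2 w\<^sub>2"
    and "\<And>k. k \<in> {1..m} \<Longrightarrow> C k =
           exp (integral {p (k - 1)..p k} (\<lambda>s. M * N\<^sub>V s * (1 + integral {0..s} N\<^sub>U)))
           + M * L\<^sub>G * D k * integral {p k - \<tau> k..p k - \<theta> k}
               (\<lambda>s. exp (integral {p (k - 1)..s} (\<lambda>\<sigma>. M * N\<^sub>V \<sigma> * (1 + integral {0..\<sigma>} N\<^sub>U))))"
  shows "sigma_norm m p (\<lambda>t. w\<^sub>1 t - w\<^sub>2 t)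
           \<le> M * history_norm r (\<lambda>u. \<zeta>\<^sub>1 u - \<zeta>\<^sub>2 u) * (\<Prod>k = 1..m. C k)
             * exp (integral {p m..b} (\<lambda>s. M * N\<^sub>V s * (1 + integral {0..s} N\<^sub>U)))"
proof (cases "\<forall>x :: 'a. x = 0")
  case True
  \<comment> \<open>In the zero space the Lipschitz bounds do not force \<open>D k \<ge> 0\<close>, but both sides vanish.\<close>
  have trivial: "norm x = 0" for x :: 'a
    using True[rule_format, of x] by simp
  show ?thesis
    using \<open>r > 0\<close> unfolding trivial sigma_norm_def history_norm_def
    using less_imp_le[OF assms(9)] by (auto simp: image_constant_conv)
next
  case False
  then obtain e :: 'a where e: "e \<noteq> 0"
    by blast
  note rpos = assms(2) and M1 = assms(5) and TM = assms(6) and p0 = assms(7) and pb = assms(8)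
    and pinc = assms(9) and \<theta>\<tau> = assms(10) and contV = assms(12) and NV = assms(13)
    and contU = assms(14) and NU = assms(15) and LG = assms(16)
    and V = assms(17) and U = assms(18) and G = assms(19) and J = assms(20)
    and sol1 = assms(23) and sol2 = assms(24) and C = assms(25)
  \<comment> \<open>Comparing the nonzero vector \<open>e\<close> with \<open>0\<close> in the
    Lipschitz bound forces the sign.\<close>
  have D: "D k \<ge> 0" if "k \<in> {1..m}" for k
  proof -
    have "0 \<le> D k * norm (e - 0)"
      using J[OF that, of e 0] norm_ge_zero order_trans by blast
    with e show ?thesis
      by (simp add: zero_le_mult_iff)
  qed
  have mono: "p i \<le> p j" if "i \<le> j" "j \<le> m + 1" for i j
    using pinc that by (rule partition_mono)
  have b: "b > 0"
    by (rule assms)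
  have ppos: "p k > 0" if "k \<in> {1..m}" for k
    using mono[of 1 k] pinc[of 0] that p0 by auto
  have w: "w\<^sub>1 \<in> solution_class r m p" "w\<^sub>2 \<in> solution_class r m p"
    using sol1 sol2 by (auto simp: mild_solution_def)

  \<comment> \<open>The running supremum of the difference and its integrability\<close>
  define d where "d t = norm (w\<^sub>1 t - w\<^sub>2 t)" for t
  define z where "z t = (SUP s\<in>{-r..t}. d s)" for t
  \<comment> \<open>The real supremum in \<open>z\<close> is meaningful only over a set bounded
    above; boundedness of both solutions supplies the bound \<open>B\<close>.\<close>
  have "bounded ((\<lambda>t. w\<^sub>1 t - w\<^sub>2 t) ` {-r..b})"
    using solution_class_bounded[OF w(1) p0 pinc] solution_class_bounded[OF w(2) p0 pinc]
    unfolding pb by (intro bounded_minus_comp)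
  then obtain B where B: "d t \<le> B" if "t \<in> {-r..b}" for t
    unfolding bounded_iff d_def by blast
  have bdd: "bdd_above (d ` {-r..t})" if "t \<le> b" for t
    using B that by (intro bdd_aboveI[of _ B]) auto
  have dz: "d s \<le> z t" if "s \<in> {-r..t}" "t \<le> b" for s t
    unfolding z_def using that bdd by (intro cSUP_upper) auto
  have z0: "z t \<ge> 0" if "t \<in> {0..b}" for t
    using order_trans[OF norm_ge_zero dz[of t t, unfolded d_def]] that rpos by auto
  have zle: "z t \<le> x" if "t \<in> {0..b}" "\<And>s. s \<in> {-r..t} \<Longrightarrow> d s \<le> x" for t x
    unfolding z_def using that rpos by (intro cSUP_least) auto
  have zmono: "z s \<le> z t" if "0 \<le> s" "s \<le> t" "t \<le> b" for s t
    by (rule zle) (use that dz in auto)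
  \<comment> \<open>\<open>z\<close> may jump right after an impulse, so its integrability comes
    from monotonicity, not from continuity.\<close>
  have zint: "z integrable_on {0..b}"
    by (rule integrable_on_mono_on) (auto simp: mono_on_def intro: zmono)
  \<comment> \<open>The second mean value theorem is applied for a by-product: it asserts that the
    product of an integrable \<open>g\<close> with the monotone \<open>z\<close> has an integral.
    The mean value \<open>c\<close> itself is discarded.\<close>
  have prodint: "(\<lambda>s. g s * z s) integrable_on {0..t}"
    if "continuous_on {0..b} g" "t \<in> {0..b}" for g t
  proof -
    have "g integrable_on {0..b}"
      using that by (intro integrable_continuous_real)
    then obtain c where "((\<lambda>x. z x * g x) has_integral (z 0 * integral {0..c} g + z b * integral {c..b} g)) {0..b}"
      using second_mean_value_theorem_full[of g 0 b z] b zmono by (metis less_imp_le)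
    then have "(\<lambda>s. g s * z s) integrable_on {0..b}"
      by (auto simp: mult.commute)
    then show ?thesis
      by (rule integrable_subinterval_real) (use that in auto)
  qed
  let ?S1 = "segment_at r w\<^sub>1" and ?S2 = "segment_at r w\<^sub>2"
  \<comment> \<open>After an impulse a segment need not be continuous; it belongs to
    \<open>histories\<close> as a segment of a function in the solution class, which makes the
    Lipschitz bounds applicable.\<close>
  have hist: "?S1 t \<in> histories r m p" "?S2 t \<in> histories r m p" if "t \<in> {0..b}" for t
    using that w pb by (auto simp: histories_def)
  have hz: "history_norm r (\<lambda>u. ?S1 t u - ?S2 t u) \<le> z t" if "t \<in> {0..b}" for t
    unfolding history_norm_def segment_at_def using rpos that dz[of _ t]
    by (intro cSUP_least) (auto simp: d_def)

  \<comment> \<open>The Gronwall kernel and the inner integrals of \<open>U\<close>\<close>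
  define n where "n s = integral {0..s} N\<^sub>U" for s
  define f where "f s = M * N\<^sub>V s * (1 + n s)" for s
  have n0: "n s \<ge> 0" if "s \<in> {0..b}" for s
    unfolding n_def using that contU NU
    by (intro integral_nonneg integrable_continuous_real) (auto intro: continuous_on_subset)
  have fcont: "continuous_on {0..b} f"
    unfolding f_def n_def
    by (intro continuous_intros contV indefinite_integral_continuous_1 integrable_continuous_real contU)
  have f0: "f s \<ge> 0" if "s \<in> {0..b}" for s
    using that NV n0 M1 by (auto simp: f_def)
  define K1 where "K1 s = integral {0..s} (\<lambda>\<sigma>. U s \<sigma> (?S1 \<sigma>))" for s
  define K2 where "K2 s = integral {0..s} (\<lambda>\<sigma>. U s \<sigma> (?S2 \<sigma>))" for s
  \<comment> \<open>The bound on \<open>U s \<sigma>\<close> carries \<open>N\<^sub>U\<close> at the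
    inner time \<sigma>. Once \<open>z \<sigma>\<close> is replaced by the larger
    \<open>z s\<close>, that factor leaves the integral and \<open>N\<^sub>U\<close> integrates to
    \<open>n s\<close>.\<close>
  have K: "norm (K1 s - K2 s) \<le> n s * z s" if s: "s \<in> {0..b}" for s
  proof -
    have int: "(\<lambda>\<sigma>. U s \<sigma> (?S1 \<sigma>)) integrable_on {0..s}" "(\<lambda>\<sigma>. U s \<sigma> (?S2 \<sigma>)) integrable_on {0..s}"
      using sol1 sol2 s pb unfolding mild_solution_def by blast+
    have NUs: "N\<^sub>U integrable_on {0..s}"
      using contU s by (intro integrable_continuous_real) (auto intro: continuous_on_subset)
    have "norm (K1 s - K2 s) = norm (integral {0..s} (\<lambda>\<sigma>. U s \<sigma> (?S1 \<sigma>) - U s \<sigma> (?S2 \<sigma>)))"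
      using int by (simp add: K1_def K2_def integral_diff)
    also have "\<dots> \<le> integral {0..s} (\<lambda>\<sigma>. N\<^sub>U \<sigma> * z s)"
    proof (rule integral_norm_bound_integral)
      fix \<sigma> assume \<sigma>: "\<sigma> \<in> {0..s}"
      then have \<sigma>b: "\<sigma> \<in> {0..b}"
        using s by auto
      have "norm (U s \<sigma> (?S1 \<sigma>) - U s \<sigma> (?S2 \<sigma>)) \<le> N\<^sub>U \<sigma> * history_norm r (\<lambda>u. ?S1 \<sigma> u - ?S2 \<sigma> u)"
        using s \<sigma>b by (intro U hist)
      also have "\<dots> \<le> N\<^sub>U \<sigma> * z s"
        using hz[OF \<sigma>b] zmono[of \<sigma> s] \<sigma> s NU[OF \<sigma>b] by (intro mult_left_mono) auto
      finally show "norm (U s \<sigma> (?S1 \<sigma>) - U s \<sigma> (?S2 \<sigma>)) \<le> N\<^sub>U \<sigma> * z s" .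
    qed (use int NUs in \<open>auto intro: integrable_diff integrable_on_mult_left\<close>)
    also have "\<dots> = n s * z s"
      by (simp add: n_def)
    finally show ?thesis .
  qed

  \<comment> \<open>The arguments of the impulse maps\<close>
  define Q1 where "Q1 k = integral {p k - \<tau> k..p k - \<theta> k} (\<lambda>s. G s (?S1 s))" for k
  define Q2 where "Q2 k = integral {p k - \<tau> k..p k - \<theta> k} (\<lambda>s. G s (?S2 s))" for k
  have window: "p (k - 1) \<le> p k - \<tau> k \<and> p k - \<theta> k \<le> p k" if "k \<in> {1..m}" for k
    using \<theta>\<tau>[OF that] by auto
  have windowb: "{p k - \<tau> k..p k - \<theta> k} \<subseteq> {0..b}" if "k \<in> {1..m}" for k
  proof -
    have "0 \<le> p (k - 1)" "p k \<le> b"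
      unfolding p0[symmetric] pb[symmetric] using that by (auto intro!: mono)
    with window[OF that] show ?thesis
      by auto
  qed
  have zwin: "z integrable_on {p k - \<tau> k..p k - \<theta> k}" "integral {p k - \<tau> k..p k - \<theta> k} z \<ge> 0"
    if "k \<in> {1..m}" for k
    using zint windowb[OF that] z0 by (blast intro: integrable_subinterval_real integral_nonneg)+
  have Q: "norm (Q1 k - Q2 k) \<le> L\<^sub>G * integral {p k - \<tau> k..p k - \<theta> k} z" if k: "k \<in> {1..m}" for k
  proof -
    let ?I = "{p k - \<tau> k..p k - \<theta> k}"
    have int: "(\<lambda>s. G s (?S1 s)) integrable_on ?I" "(\<lambda>s. G s (?S2 s)) integrable_on ?I"
      using sol1 sol2 k unfolding mild_solution_def by blast+
    have "norm (Q1 k - Q2 k) = norm (integral ?I (\<lambda>s. G s (?S1 s) - G s (?S2 s)))"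
      using int by (simp add: Q1_def Q2_def integral_diff)
    also have "\<dots> \<le> integral ?I (\<lambda>s. L\<^sub>G * z s)"
    proof (rule integral_norm_bound_integral)
      fix s assume "s \<in> ?I"
      then have s: "s \<in> {0..b}"
        using windowb[OF k] by blast
      have "norm (G s (?S1 s) - G s (?S2 s)) \<le> L\<^sub>G * history_norm r (\<lambda>u. ?S1 s u - ?S2 s u)"
        using s by (intro G hist)
      also have "\<dots> \<le> L\<^sub>G * z s"
        using hz[OF s] LG by (intro mult_left_mono) auto
      finally show "norm (G s (?S1 s) - G s (?S2 s)) \<le> L\<^sub>G * z s" .
    qed (use int zwin[OF k] in \<open>auto intro: integrable_diff integrable_on_mult_right\<close>)
    also have "\<dots> = L\<^sub>G * integral ?I z"
      by simp
    finally show ?thesis .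
  qed
  have Tb: "norm (T t x) \<le> M * norm x" if "t \<ge> 0" for t x
    using norm_blinfun[of "T t" x] mult_right_mono[OF TM[OF that], of "norm x"] by simp

  \<comment> \<open>The integral inequality for the running supremum\<close>
  define h where "h = history_norm r (\<lambda>u. \<zeta>\<^sub>1 u - \<zeta>\<^sub>2 u)"
  \<comment> \<open>On the history interval each solution equals its initial function, so the
    distance \<open>h\<close> of the initial functions is the starting value
    \<open>z 0\<close>.\<close>
  have "(\<lambda>u. norm (\<zeta>\<^sub>1 u - \<zeta>\<^sub>2 u)) ` {-r..0} = d ` {-r..0}"
    using sol1 sol2 by (intro image_cong) (auto simp: d_def mild_solution_def)
  then have hz0: "h = z 0"
    by (simp add: h_def history_norm_def z_def)
  have h: "d t \<le> h" if "t \<in> {-r..0}" for t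
    unfolding hz0 using dz[of t 0] that b by auto
  have \<zeta>0: "norm (\<zeta>\<^sub>1 0 - \<zeta>\<^sub>2 0) \<le> h"
    using h[of 0] sol1 sol2 rpos by (auto simp: d_def mild_solution_def)
  have h0: "h \<ge> 0"
    using \<zeta>0 norm_ge_zero order_trans by blast
  \<comment> \<open>\<open>M\<close> comes from the semigroup, \<open>L\<^sub>G\<close> from
    \<open>G\<close> and \<open>D k\<close> from \<open>J k\<close>; the product is the coefficient
    of the second summand of \<open>C k\<close>.\<close>
  define \<beta> where "\<beta> k = M * L\<^sub>G * D k" for k
  have \<beta>0: "\<beta> k \<ge> 0" if "k \<in> {1..m}" for k
    using D[OF that] M1 LG by (simp add: \<beta>_def)
  define imp where "imp t = (\<Sum>k | k \<in> {1..m} \<and> p k < t. \<beta> k * integral {p k - \<tau> k..p k - \<theta> k} z)" for t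
  \<comment> \<open>\<open>R\<close> first bounds \<open>d\<close> pointwise. Since \<open>R\<close>
    is nondecreasing, a bound at an earlier time remains valid at \<open>t\<close>, and so the bound
    passes to the supremum \<open>z\<close>.\<close>
  define R where "R t = M * h + integral {0..t} (\<lambda>s. f s * z s) + imp t" for t
  have dR: "d t \<le> R t" if t: "t \<in> {0..b}" for t
  proof -
    let ?F1 = "\<lambda>s. T (t - s) (V s (?S1 s) (K1 s))" and ?F2 = "\<lambda>s. T (t - s) (V s (?S2 s) (K2 s))"
    let ?N = "{k. k \<in> {1..m} \<and> p k < t}"
    have int: "?F1 integrable_on {0..t}" "?F2 integrable_on {0..t}"
      using sol1 sol2 t pb unfolding mild_solution_def K1_def K2_def by blast+
    have "{k. k \<in> {1..m} \<and> 0 < p k \<and> p k < t} = ?N"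
      using ppos by auto
    then have "w\<^sub>1 t = T t (\<zeta>\<^sub>1 0) + integral {0..t} ?F1 + (\<Sum>k\<in>?N. T (t - p k) (J k (Q1 k)))"
      "w\<^sub>2 t = T t (\<zeta>\<^sub>2 0) + integral {0..t} ?F2 + (\<Sum>k\<in>?N. T (t - p k) (J k (Q2 k)))"
      using sol1 sol2 t pb unfolding mild_solution_def K1_def K2_def Q1_def Q2_def by simp_all
    then have "w\<^sub>1 t - w\<^sub>2 t = T t (\<zeta>\<^sub>1 0 - \<zeta>\<^sub>2 0) + integral {0..t} (\<lambda>s. ?F1 s - ?F2 s)
      + (\<Sum>k\<in>?N. T (t - p k) (J k (Q1 k) - J k (Q2 k)))"
      using int by (simp add: integral_diff blinfun.diff_right sum_subtractf)
    then have "d t \<le> norm (T t (\<zeta>\<^sub>1 0 - \<zeta>\<^sub>2 0)) + norm (integral {0..t} (\<lambda>s. ?F1 s - ?F2 s))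
      + norm (\<Sum>k\<in>?N. T (t - p k) (J k (Q1 k) - J k (Q2 k)))"
      unfolding d_def by (auto intro: norm_triangle_mono norm_triangle_ineq)
    moreover have "norm (T t (\<zeta>\<^sub>1 0 - \<zeta>\<^sub>2 0)) \<le> M * h"
      using t M1 by (intro order_trans[OF Tb mult_left_mono[OF \<zeta>0]]) auto
    moreover have "norm (integral {0..t} (\<lambda>s. ?F1 s - ?F2 s)) \<le> integral {0..t} (\<lambda>s. f s * z s)"
    proof (rule integral_norm_bound_integral)
      fix s assume s: "s \<in> {0..t}"
      then have sb: "s \<in> {0..b}"
        using t by auto
      have "norm (?F1 s - ?F2 s) \<le> M * norm (V s (?S1 s) (K1 s) - V s (?S2 s) (K2 s))"
        using Tb[of "t - s"] s by (simp flip: blinfun.diff_right)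
      also have "norm (V s (?S1 s) (K1 s) - V s (?S2 s) (K2 s))
        \<le> N\<^sub>V s * (history_norm r (\<lambda>u. ?S1 s u - ?S2 s u) + norm (K1 s - K2 s))"
        using sb by (intro V hist)
      \<comment> \<open>Both contributions now contain the factor \<open>z s\<close>, and
        multiplying by \<open>M\<close> produces exactly the kernel \<open>f s\<close>.\<close>
      also have "\<dots> \<le> N\<^sub>V s * (z s + n s * z s)"
        using hz[OF sb] K[OF sb] NV[OF sb] by (intro mult_left_mono add_mono)
      finally show "norm (?F1 s - ?F2 s) \<le> f s * z s"
        using M1 by (simp add: f_def algebra_simps)
    qed (use int prodint[OF fcont t] in \<open>auto intro: integrable_diff\<close>)
    moreover have "norm (\<Sum>k\<in>?N. T (t - p k) (J k (Q1 k) - J k (Q2 k))) \<le> imp t"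
      unfolding imp_def
    proof (rule sum_norm_le)
      fix k assume "k \<in> ?N"
      then have k: "k \<in> {1..m}" "p k < t"
        by auto
      have "norm (T (t - p k) (J k (Q1 k) - J k (Q2 k))) \<le> M * norm (J k (Q1 k) - J k (Q2 k))"
        using k by (intro Tb) auto
      also have "\<dots> \<le> M * (D k * (L\<^sub>G * integral {p k - \<tau> k..p k - \<theta> k} z))"
        using J[OF k(1), of "Q1 k" "Q2 k"] mult_left_mono[OF Q[OF k(1)] D[OF k(1)]] M1
        by (intro mult_left_mono) auto
      finally show "norm (T (t - p k) (J k (Q1 k) - J k (Q2 k)))
        \<le> \<beta> k * integral {p k - \<tau> k..p k - \<theta> k} z"
        by (simp add: \<beta>_def algebra_simps)
    qed
    ultimately show ?thesis
      by (simp add: R_def)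
  qed
  have Rmono: "R s \<le> R t" if "0 \<le> s" "s \<le> t" "t \<le> b" for s t
  proof -
    have "integral {0..s} (\<lambda>s. f s * z s) \<le> integral {0..t} (\<lambda>s. f s * z s)"
      using that prodint[OF fcont] f0 z0 by (intro integral_subset_le) auto
    moreover have "imp s \<le> imp t"
      unfolding imp_def using that \<beta>0 zwin by (intro sum_mono2) auto
    ultimately show ?thesis
      by (simp add: R_def)
  qed
  \<comment> \<open>Positive times are covered by \<open>dR\<close>. On the history interval
    \<open>d s \<le> h \<le> M * h = R 0\<close>, by \<open>M \<ge> 1\<close> and because no impulse
    time precedes \<open>0\<close>.\<close>
  have zR: "z t \<le> R t" if t: "t \<in> {0..b}" for t
  proof (rule zle[OF t])
    fix s assume s: "s \<in> {-r..t}"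
    show "d s \<le> R t"
    proof (cases "s \<le> 0")
      case True
      have "{k. k \<in> {1..m} \<and> p k < 0} = {}"
        using ppos by force
      then have "R 0 = M * h"
        unfolding R_def imp_def by (simp only: sum.empty) simp
      moreover have "d s \<le> h"
        using h s True by auto
      moreover have "h \<le> M * h"
        using M1 h0 by (simp add: mult_le_cancel_right1)
      ultimately show ?thesis
        using Rmono[of 0 t] t by auto
    next
      case False
      then show ?thesis
        using dR[of s] Rmono[of s t] s t by auto
    qed
  qed

  \<comment> \<open>Application of the impulsive Gronwall inequality\<close>
  have "z b \<le> M * h * (\<Prod>k = 1..m. C k) * exp (integral {p m..b} f)"
    unfolding pb[symmetric]
  \<comment> \<open>The instance has \<open>c = M * h\<close> and windows from
    \<open>p k - \<tau> k\<close> to \<open>p k - \<theta> k\<close>; the given formula for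
    \<open>C k\<close> is the required one after unfolding \<open>f\<close>, \<open>n\<close> and
    \<beta>.\<close>
  proof (rule impulsive_gronwall)
    show "z t \<le> M * h + integral {p 0..t} (\<lambda>s. f s * z s)
      + (\<Sum>k | k \<in> {1..m} \<and> p k < t. \<beta> k * integral {p k - \<tau> k..p k - \<theta> k} z)"
      if "t \<in> {p 0..p (m + 1)}" for t
      using zR[of t] that unfolding R_def imp_def p0 pb by simp
    show "C k = exp (integral {p (k - 1)..p k} f)
      + \<beta> k * integral {p k - \<tau> k..p k - \<theta> k} (\<lambda>s. exp (integral {p (k - 1)..s} f))"
      if "k \<in> {1..m}" for k
      using C[OF that] unfolding f_def[abs_def] n_def[abs_def] \<beta>_def .
  qed (use pinc fcont f0 zint z0 prodint[OF fcont, of b] \<beta>0 window b in \<open>simp_all add: p0 pb[simplified]\<close>)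
  moreover have "sigma_norm m p (\<lambda>t. w\<^sub>1 t - w\<^sub>2 t) \<le> z b"
  proof -
    have "(SUP t\<in>{p k..p (k + 1)}. norm (w\<^sub>1 t - w\<^sub>2 t)) \<le> z b" if "k \<le> m" for k
    proof (rule cSUP_least)
      show "{p k..p (k + 1)} \<noteq> {}"
        using pinc[OF that] by auto
      show "norm (w\<^sub>1 t - w\<^sub>2 t) \<le> z b" if "t \<in> {p k..p (k + 1)}" for t
        using dz[of t b] mono[of 0 k] mono[of "k + 1" "m + 1"] \<open>k \<le> m\<close> that p0 pb rpos
        by (auto simp: d_def)
    qed
    then show ?thesis
      by (auto simp: sigma_norm_def)
  qed
  ultimately show ?thesis
    by (simp add: h_def f_def[abs_def] n_def[abs_def])
qed

end
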